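(* Let $h\in\overline{\mathcal{C}_{e,n}}$ be a non-negative form of degree $e\ge 0$. Then the function $$f_h:\mathcal{C}_{d,n}\to\mathbb{R},\qquad g\mapsto\int_{\{\mathbf{x}\in\mathbb{R}^n:\,g(\mathbf{x})\le 1\}}h(\mathbf{x})\,\mathrm{d}\mathbf{x},$$ is completely monotone.
   Context: $n$ is a positive integer, $d\ge 2$ and $e\ge 0$ are even. $\mathcal{C}_{d,n}$ is the open convex cone, in the space $\mathcal{H}_{d,n}$ of real $n$-variate forms (homogeneous polynomials) of degree $d$, of forms strictly positive on $\mathbb{R}^n\setminus\{\mathbf{0}\}$; $\overline{\mathcal{C}_{e,n}}$ is the cone of degree $e$ forms that are non-negative on $\mathbb{R}^n$. A function $F:C\to\mathbb{R}$ on an open convex cone $C$ of a finite-dimensional real vector space is completely monotone if it is $C^\infty$ and $(-1)^kD_{v_1}\cdots D_{v_k}F\ge 0$ on $C$ for all $k\in\mathbb{N}$ and all $v_1,\dots,v_k\in C$, where $D_v$ is the directional derivative along $v$. *)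

theory Defs
  imports "HOL-Analysis.Analysis"
begin

text \<open>
  A real polynomial in the variables \<open>x $ i\<close>, \<open>i :: 'n\<close>, is given by its coefficient family
  \<open>p :: ('n \<Rightarrow> nat) \<Rightarrow> real\<close>, where \<open>p \<alpha>\<close> is the coefficient of the monomial with exponent \<open>\<alpha>\<close>.
  Vector space operations on coefficient families are pointwise.
\<close>

definition poly_eval :: "(('n::finite \<Rightarrow> nat) \<Rightarrow> real) \<Rightarrow> real ^ 'n \<Rightarrow> real" where
  "poly_eval p x = (\<Sum>\<alpha> | p \<alpha> \<noteq> 0. p \<alpha> * (\<Prod>i\<in>UNIV. (x $ i) ^ \<alpha> i))"

definition forms :: "nat \<Rightarrow> (('n::finite \<Rightarrow> nat) \<Rightarrow> real) set" where
  "forms d = {p. \<forall>\<alpha>. p \<alpha> \<noteq> 0 \<longrightarrow> (\<Sum>i\<in>UNIV. \<alpha> i) = d}"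

lemma finite_exponents: "finite {\<alpha> :: 'n::finite \<Rightarrow> nat. (\<Sum>i\<in>UNIV. \<alpha> i) = d}"
proof (rule finite_subset)
  show "{\<alpha> :: 'n \<Rightarrow> nat. (\<Sum>i\<in>UNIV. \<alpha> i) = d} \<subseteq> PiE UNIV (\<lambda>_. {..d})"
    by (auto intro: member_le_sum)
  show "finite (PiE (UNIV :: 'n set) (\<lambda>_. {..d}))"
    by (intro finite_PiE) auto
qed

lemma finite_support_form: "p \<in> forms d \<Longrightarrow> finite {\<alpha>. p \<alpha> \<noteq> 0}"
  by (rule finite_subset[OF _ finite_exponents[of d]]) (auto simp: forms_def)

definition pos_forms :: "nat \<Rightarrow> (('n::finite \<Rightarrow> nat) \<Rightarrow> real) set" where
  "pos_forms d = {g \<in> forms d. \<forall>x. x \<noteq> 0 \<longrightarrow> 0 < poly_eval g x}"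

definition nonneg_forms :: "nat \<Rightarrow> (('n::finite \<Rightarrow> nat) \<Rightarrow> real) set" where
  "nonneg_forms e = {h \<in> forms e. \<forall>x. 0 \<le> poly_eval h x}"

definition dir_deriv ::
    "('i \<Rightarrow> real) \<Rightarrow> (('i \<Rightarrow> real) \<Rightarrow> real) \<Rightarrow> ('i \<Rightarrow> real) \<Rightarrow> real" where
  "dir_deriv v F g = deriv (\<lambda>t. F (\<lambda>i. g i + t * v i)) 0"

text \<open>
  In the next two definitions \<open>V\<close> is a finite-dimensional linear subspace of \<open>'i \<Rightarrow> real\<close> and
  \<open>C \<subseteq> V\<close> is open in \<open>V\<close>. The product topology on \<open>'i \<Rightarrow> real\<close>, used by \<^const>\<open>continuous_on\<close>,
  induces on \<open>V\<close> its usual topology, and \<open>g + t v\<close> stays in \<open>C\<close> for \<open>g \<in> C\<close>, \<open>v \<in> V\<close> and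
  small \<open>t\<close>, so values of \<open>F\<close> outside \<open>C\<close> play no role. The iterated derivative
  \<open>D\<^bsub>v1\<^esub> \<dots> D\<^bsub>vk\<^esub> F\<close> is \<open>foldr dir_deriv [v1, \<dots>, vk] F\<close>. A function is of class \<open>C\<^sup>\<infinity>\<close> if its
  iterated directional derivatives of all orders exist and are continuous.
\<close>

definition smooth_on ::
    "('i \<Rightarrow> real) set \<Rightarrow> ('i \<Rightarrow> real) set \<Rightarrow> (('i \<Rightarrow> real) \<Rightarrow> real) \<Rightarrow> bool" where
  "smooth_on V C F \<longleftrightarrow>
    (\<forall>vs. set vs \<subseteq> V \<longrightarrow>
      continuous_on C (foldr dir_deriv vs F) \<and>
      (\<forall>v\<in>V. \<forall>g\<in>C. (\<lambda>t. foldr dir_deriv vs F (\<lambda>i. g i + t * v i)) differentiable at 0))"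

definition completely_monotone_on ::
    "('i \<Rightarrow> real) set \<Rightarrow> ('i \<Rightarrow> real) set \<Rightarrow> (('i \<Rightarrow> real) \<Rightarrow> real) \<Rightarrow> bool" where
  "completely_monotone_on V C F \<longleftrightarrow>
    smooth_on V C F \<and>
    (\<forall>vs. set vs \<subseteq> C \<longrightarrow> (\<forall>g\<in>C. 0 \<le> (-1) ^ length vs * foldr dir_deriv vs F g))"

end

theory Submission
  imports Defs
begin

text \<open>
  Write \<open>exp (- g x)\<close> as the integral of \<open>exp (- t)\<close> over \<open>t \<ge> g x\<close> and exchange the order of
  integration. By homogeneity the integral of \<open>h\<close> over \<open>{g \<le> t}\<close> is \<open>t powr ((n + e) / d)\<close> times
  the integral over \<open>{g \<le> 1}\<close>, so
  \<open>\<integral> h exp (- g) = \<Gamma> (1 + (n + e) / d) \<integral>\<^bsub>{g \<le> 1}\<^esub> h\<close>. The left-hand side can be differentiated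
  under the integral sign: each derivative along \<open>v\<close> multiplies the integrand by \<open>- v\<close>, which is
  nonpositive for \<open>v\<close> in the cone.
\<close>

section \<open>Sublevel-set integrals of homogeneous functions as exponential integrals\<close>

lemma nn_integral_exp_minus_atLeast:
  "(\<integral>\<^sup>+t. ennreal (exp (- t)) * indicator {a..} t \<partial>lborel) = ennreal (exp (- a))" for a :: real
proof -
  have "(\<integral>\<^sup>+t. ennreal (exp (- t)) * indicator {a..} t \<partial>lborel) = ennreal (0 - (- exp (- a)))"
  proof (rule nn_integral_FTC_atLeast)
    show "((\<lambda>t :: real. - exp (- t)) has_real_derivative exp (- t)) (at t)" for t
      by (auto intro!: derivative_eq_intros)
    show "((\<lambda>t :: real. - exp (- t)) \<longlongrightarrow> 0) at_top"
      using tendsto_minus[OF filterlim_compose[OF exp_at_bot filterlim_uminus_at_bot_at_top]]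
      by simp
  qed auto
  then show ?thesis by simp
qed

text \<open>Substitute \<open>s *\<^sub>R x\<close> for \<open>x\<close>, where
  \<open>s ^ d = t\<close>: this turns the condition \<open>g x \<le> t\<close> into
  \<open>g x \<le> 1\<close>. The Jacobian contributes \<open>s ^ DIM('a)\<close> and the
  homogeneity of \<open>h\<close> contributes \<open>s ^ m\<close>; together they are the stated
  power of \<open>t\<close>.\<close>

lemma nn_integral_sublevel_scale:
  fixes g h :: "'a::euclidean_space \<Rightarrow> real"
  assumes [measurable]: "g \<in> borel_measurable borel" "h \<in> borel_measurable borel"
    and "d > 0" "t > 0"
    and g: "\<And>s x. s > 0 \<Longrightarrow> g (s *\<^sub>R x) = s ^ d * g x"
    and h: "\<And>s x. s > 0 \<Longrightarrow> h (s *\<^sub>R x) = s ^ m * h x"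
  shows "(\<integral>\<^sup>+x. ennreal (h x) * indicator {x. g x \<le> t} x \<partial>lborel) =
    ennreal (t powr ((DIM('a) + m) / d)) * (\<integral>\<^sup>+x. ennreal (h x) * indicator {x. g x \<le> 1} x \<partial>lborel)"
proof -
  define s where "s = t powr (1 / d)"
  have s: "s > 0" "s ^ d = t"
    using assms by (auto simp: s_def powr_power)
  have sp: "s ^ DIM('a) * s ^ m = t powr ((DIM('a) + m) / d)"
    using assms by (auto simp: s_def powr_power powr_add[symmetric] add_divide_distrib)
  have "(\<integral>\<^sup>+x. ennreal (h x) * indicator {x. g x \<le> t} x \<partial>lborel) =
      (\<integral>\<^sup>+x. ennreal (h x) * indicator {x. g x \<le> t} x
        \<partial>density (distr lborel borel (\<lambda>x. 0 + s *\<^sub>R x)) (\<lambda>_. \<bar>s\<bar> ^ DIM('a)))"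
    using s by (subst lborel_affine[of s 0]) auto
  also have "\<dots> = (\<integral>\<^sup>+x. ennreal (s ^ DIM('a)) *
      (ennreal (h (s *\<^sub>R x)) * indicator {x. g x \<le> t} (s *\<^sub>R x)) \<partial>lborel)"
    using s by (subst nn_integral_density, simp, simp, subst nn_integral_distr) auto
  also have "\<dots> = (\<integral>\<^sup>+x. ennreal (s ^ DIM('a) * s ^ m) *
      (ennreal (h x) * indicator {x. g x \<le> 1} x) \<partial>lborel)"
  proof (intro nn_integral_cong)
    fix x :: 'a
    have "g (s *\<^sub>R x) \<le> t \<longleftrightarrow> g x \<le> 1"
      using s g[of s x] \<open>t > 0\<close> mult_le_cancel_left_pos[of t "g x" 1] by simp
    then show "ennreal (s ^ DIM('a)) * (ennreal (h (s *\<^sub>R x)) * indicator {x. g x \<le> t} (s *\<^sub>R x)) =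
        ennreal (s ^ DIM('a) * s ^ m) * (ennreal (h x) * indicator {x. g x \<le> 1} x)"
      using s h[of s x] by (simp add: indicator_def ennreal_mult' mult.assoc)
  qed
  also have "\<dots> = ennreal (t powr ((DIM('a) + m) / d)) *
      (\<integral>\<^sup>+x. ennreal (h x) * indicator {x. g x \<le> 1} x \<partial>lborel)"
    unfolding sp by (rule nn_integral_cmult) measurable
  finally show ?thesis .
qed

text \<open>Working with nonnegative extended integrals lets the order of integration be exchanged
  before anything is known to be finite. The identity thus also covers infinite values, and it
  serves later as a way to prove integrability.\<close>

lemma nn_integral_homogeneous_exp:
  fixes g h :: "'a::euclidean_space \<Rightarrow> real"
  assumes [measurable]: "g \<in> borel_measurable borel" "h \<in> borel_measurable borel"
    and "d > 0"
    and g: "\<And>s x. s > 0 \<Longrightarrow> g (s *\<^sub>R x) = s ^ d * g x" "\<And>x. 0 \<le> g x"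
    and h: "\<And>s x. s > 0 \<Longrightarrow> h (s *\<^sub>R x) = s ^ m * h x" "\<And>x. 0 \<le> h x"
  shows "(\<integral>\<^sup>+x. ennreal (h x * exp (- g x)) \<partial>lborel) =
    ennreal (Gamma (1 + (DIM('a) + m) / d)) *
    (\<integral>\<^sup>+x. ennreal (h x) * indicator {x. g x \<le> 1} x \<partial>lborel)"
proof -
  let ?I = "\<integral>\<^sup>+x. ennreal (h x) * indicator {x. g x \<le> 1} x \<partial>lborel"
  let ?a = "(DIM('a) + m) / d"
  have a: "?a > 0" using \<open>d > 0\<close> by (simp add: add_pos_nonneg)
  have "(\<integral>\<^sup>+x. ennreal (h x * exp (- g x)) \<partial>lborel) =
      (\<integral>\<^sup>+x. \<integral>\<^sup>+t. ennreal (h x) * (ennreal (exp (- t)) * indicator {g x..} t) \<partial>lborel \<partial>lborel)"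
    using h by (subst nn_integral_cmult)
      (auto simp: nn_integral_exp_minus_atLeast ennreal_mult)
  \<comment> \<open>The indicator becomes a predicate in \<open>x\<close> and \<open>t\<close>
    jointly, as the exchange of integrals needs joint measurability.\<close>
  also have "\<dots> = (\<integral>\<^sup>+x. \<integral>\<^sup>+t. ennreal (h x) * (ennreal (exp (- t)) * of_bool (g x \<le> t)) \<partial>lborel \<partial>lborel)"
    by (intro nn_integral_cong) (auto simp: indicator_def)
  also have "\<dots> = (\<integral>\<^sup>+t. \<integral>\<^sup>+x. ennreal (h x) * (ennreal (exp (- t)) * of_bool (g x \<le> t)) \<partial>lborel \<partial>lborel)"
    by (rule lborel_pair.Fubini'[symmetric]) measurable
  also have "\<dots> = (\<integral>\<^sup>+t. \<integral>\<^sup>+x. ennreal (exp (- t)) * (ennreal (h x) * indicator {x. g x \<le> t} x) \<partial>lborel \<partial>lborel)"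
    by (intro nn_integral_cong) (auto simp: indicator_def mult.commute)
  also have "\<dots> = (\<integral>\<^sup>+t. ennreal (exp (- t)) * (\<integral>\<^sup>+x. ennreal (h x) * indicator {x. g x \<le> t} x \<partial>lborel) \<partial>lborel)"
    by (intro nn_integral_cong nn_integral_cmult) measurable
  also have "\<dots> = (\<integral>\<^sup>+t. ennreal (indicator {0..} t * t powr (1 + ?a - 1) / exp t) * ?I \<partial>lborel)"
  proof (intro nn_integral_cong_AE)
    have "AE t in lborel. t \<noteq> (0::real)"
      by (rule AE_lborel_singleton)
    then show "AE t in lborel. ennreal (exp (- t)) *
        (\<integral>\<^sup>+x. ennreal (h x) * indicator {x. g x \<le> t} x \<partial>lborel) =
        ennreal (indicator {0..} t * t powr (1 + ?a - 1) / exp t) * ?I"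
    proof eventually_elim
      case (elim t)
      show ?case
      proof (cases "t > 0")
        case True
        then show ?thesis
          using nn_integral_sublevel_scale[of g h d t m] assms
          by (simp add: exp_minus divide_inverse mult.commute[of "t powr _"] ennreal_mult mult.assoc)
      next
        case False
        then have "\<not> g x \<le> t" for x using g(2)[of x] elim by linarith
        then show ?thesis using False elim by simp
      qed
    qed
  qed
  also have "\<dots> = ennreal (Gamma (1 + ?a)) * ?I"
    using a by (subst nn_integral_multc) (auto simp: Gamma_conv_nn_integral_real)
  finally show ?thesis .
qed

text \<open>No integrability is assumed: for a nonnegative measurable function the Bochner integral
  is \<open>enn2real\<close> of the extended one, so an infinite value becomes 0 on both
  sides.\<close>

lemma integral_homogeneous_exp:
  fixes g h :: "'a::euclidean_space \<Rightarrow> real"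
  assumes [measurable]: "g \<in> borel_measurable borel" "h \<in> borel_measurable borel"
    and "d > 0"
    and g: "\<And>s x. s > 0 \<Longrightarrow> g (s *\<^sub>R x) = s ^ d * g x" "\<And>x. 0 \<le> g x"
    and h: "\<And>s x. s > 0 \<Longrightarrow> h (s *\<^sub>R x) = s ^ m * h x" "\<And>x. 0 \<le> h x"
  shows "(LINT x|lborel. h x * exp (- g x)) =
    Gamma (1 + (DIM('a) + m) / d) * (LINT x:{x. g x \<le> 1}|lborel. h x)"
proof -
  have "0 < 1 + (DIM('a) + m) / d" by (simp add: add_pos_nonneg)
  then have G: "0 \<le> Gamma (1 + (DIM('a) + m) / d)"
    by (simp add: Gamma_real_pos less_imp_le)
  have "(LINT x|lborel. h x * exp (- g x)) = enn2real (\<integral>\<^sup>+x. ennreal (h x * exp (- g x)) \<partial>lborel)"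
    using h by (intro integral_eq_nn_integral) auto
  also have "\<dots> = Gamma (1 + (DIM('a) + m) / d) *
      enn2real (\<integral>\<^sup>+x. ennreal (h x) * indicator {x. g x \<le> 1} x \<partial>lborel)"
    using nn_integral_homogeneous_exp[of g h d m] assms G by (simp add: enn2real_mult)
  also have "(\<integral>\<^sup>+x. ennreal (h x) * indicator {x. g x \<le> 1} x \<partial>lborel) =
      (\<integral>\<^sup>+x. ennreal (indicator {x. g x \<le> 1} x *\<^sub>R h x) \<partial>lborel)"
    by (intro nn_integral_cong) (auto simp: indicator_def)
  also have "enn2real \<dots> = (LINT x:{x. g x \<le> 1}|lborel. h x)"
    unfolding set_lebesgue_integral_def using h
    by (intro integral_eq_nn_integral[symmetric]) auto
  finally show ?thesis .
qed

section \<open>Integrability against exponential weights\<close>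

text \<open>The preceding identity, applied to the homogeneous functions
  \<open>c * norm x ^ d\<close> and \<open>norm x ^ m\<close>, reduces finiteness over the whole
  space to an integral over a bounded sublevel set.\<close>

lemma integrable_norm_power_exp:
  assumes "c > 0" "d > 0"
  shows "integrable lborel (\<lambda>x :: 'a::euclidean_space. norm x ^ m * exp (- (c * norm x ^ d)))"
proof (rule integrableI_bounded)
  let ?S = "{x :: 'a. c * norm x ^ d \<le> 1}"
  have "(\<integral>\<^sup>+x. norm (norm (x :: 'a) ^ m * exp (- (c * norm x ^ d))) \<partial>lborel) =
     (\<integral>\<^sup>+x. ennreal (norm (x :: 'a) ^ m * exp (- (c * norm x ^ d))) \<partial>lborel)"
    by (intro nn_integral_cong) auto
  also have "\<dots> = ennreal (Gamma (1 + (DIM('a) + m) / d)) *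
      (\<integral>\<^sup>+x. ennreal (norm (x :: 'a) ^ m) * indicator ?S x \<partial>lborel)"
    using assms by (intro nn_integral_homogeneous_exp) (auto simp: power_mult_distrib)
  also have "\<dots> < \<infinity>"
  proof -
    \<comment> \<open>Outside the unit ball \<open>norm x \<le> norm x ^ d\<close>, so a point of
      \<open>?S\<close> there satisfies \<open>c * norm x \<le> 1\<close>.\<close>
    define R where "R = max 1 (1 / c)"
    have R: "norm x \<le> R" if "x \<in> ?S" for x :: 'a
    proof (cases "norm x \<le> 1")
      case False
      then have "norm x ^ 1 \<le> norm x ^ d"
        using \<open>d > 0\<close> by (intro power_increasing) auto
      then have "c * norm x \<le> 1"
        using that order_trans[OF mult_left_mono[of "norm x" "norm x ^ d" c]] \<open>c > 0\<close> by simp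
      then show ?thesis using \<open>c > 0\<close> by (simp add: R_def le_max_iff_disj field_simps)
    qed (auto simp: R_def)
    have "(\<integral>\<^sup>+x. ennreal (norm (x :: 'a) ^ m) * indicator ?S x \<partial>lborel) \<le>
        (\<integral>\<^sup>+x. ennreal (R ^ m) * indicator (cball 0 R :: 'a set) x \<partial>lborel)"
      using R by (intro nn_integral_mono)
        (auto simp: indicator_def intro!: ennreal_leI power_mono)
    also have "\<dots> = ennreal (R ^ m) * emeasure lborel (cball 0 R :: 'a set)"
      by (intro nn_integral_cmult_indicator) auto
    also have "\<dots> < \<infinity>"
      using emeasure_bounded_finite[OF bounded_cball, of "0 :: 'a" R]
      by (simp add: ennreal_mult_less_top)
    finally show ?thesis by (simp add: ennreal_mult_less_top)
  qed
  finally show "(\<integral>\<^sup>+x. norm (norm (x :: 'a) ^ m * exp (- (c * norm x ^ d))) \<partial>lborel) < \<infinity>" .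
qed measurable

lemma integrable_mult_exp:
  fixes q g :: "'a::euclidean_space \<Rightarrow> real"
  assumes [measurable]: "q \<in> borel_measurable borel" "g \<in> borel_measurable borel"
    and q: "\<And>x. \<bar>q x\<bar> \<le> K * norm x ^ m"
    and g: "\<And>x. c * norm x ^ d \<le> g x" and "c > 0" "d > 0"
  shows "integrable lborel (\<lambda>x. q x * exp (- g x))"
proof (rule Bochner_Integration.integrable_bound)
  show "integrable lborel (\<lambda>x :: 'a. K * (norm x ^ m * exp (- (c * norm x ^ d))))"
    by (intro integrable_mult_right integrable_norm_power_exp assms)
  have "\<bar>q x * exp (- g x)\<bar> \<le> \<bar>K * (norm x ^ m * exp (- (c * norm x ^ d)))\<bar>" for x
  proof -
    have "\<bar>q x\<bar> * exp (- g x) \<le> (K * norm x ^ m) * exp (- (c * norm x ^ d))"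
      using q[of x] g[of x] by (intro mult_mono) (auto intro: order_trans[OF abs_ge_zero])
    then show ?thesis
      by (intro order_trans[OF _ abs_ge_self]) (simp add: abs_mult mult.assoc)
  qed
  then show "AE x in lborel. norm (q x * exp (- g x)) \<le>
      norm (K * (norm x ^ m * exp (- (c * norm x ^ d))))"
    by simp
qed measurable

section \<open>Evaluation of forms, growth bounds and positivity\<close>

text \<open>The sum defining \<open>poly_eval\<close> ranges over the support of \<open>p\<close>.
  Passing to a finite range common to all forms of degree \<open>d\<close> makes evaluation visibly
  linear in the coefficients.\<close>

lemma poly_eval_form:
  assumes "p \<in> forms d"
  shows "poly_eval p x = (\<Sum>\<alpha> | (\<Sum>i\<in>UNIV. \<alpha> i) = d. p \<alpha> * (\<Prod>i\<in>UNIV. (x $ i) ^ \<alpha> i))"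
  unfolding poly_eval_def
  using assms by (intro sum.mono_neutral_left finite_exponents) (auto simp: forms_def)

lemma forms_add_scale:
  "p \<in> forms d \<Longrightarrow> q \<in> forms d \<Longrightarrow> (\<lambda>\<alpha>. p \<alpha> + t * q \<alpha>) \<in> forms d"
  by (force simp: forms_def)

lemma poly_eval_add_scale:
  assumes "p \<in> forms d" "q \<in> forms d"
  shows "poly_eval (\<lambda>\<alpha>. p \<alpha> + t * q \<alpha>) x = poly_eval p x + t * poly_eval q x"
  unfolding poly_eval_form[OF assms(1)] poly_eval_form[OF assms(2)]
    poly_eval_form[OF forms_add_scale[OF assms]]
  by (simp add: sum.distrib sum_distrib_left algebra_simps)

lemma continuous_on_poly_eval [continuous_intros]: "continuous_on S (poly_eval p)"
  unfolding poly_eval_def by (intro continuous_intros)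

lemma borel_measurable_poly_eval [measurable]: "poly_eval p \<in> borel_measurable borel"
  by (intro borel_measurable_continuous_onI continuous_on_poly_eval)

lemma poly_eval_scaleR:
  assumes "p \<in> forms d"
  shows "poly_eval p (s *\<^sub>R x) = s ^ d * poly_eval p x"
proof -
  have "(\<Prod>i\<in>UNIV. (s * x $ i) ^ \<alpha> i) = s ^ d * (\<Prod>i\<in>UNIV. (x $ i) ^ \<alpha> i)"
    if "(\<Sum>i\<in>UNIV. \<alpha> i) = d" for \<alpha>
    using that by (auto simp: power_mult_distrib prod.distrib simp flip: power_sum)
  then show ?thesis
    unfolding poly_eval_form[OF assms] sum_distrib_left
    by (intro sum.cong) auto
qed

text \<open>This norm serves two purposes: it controls the values of a form, and as a finite sum
  over coordinates it is continuous in the product topology.\<close>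

definition coeff_norm :: "nat \<Rightarrow> (('n::finite \<Rightarrow> nat) \<Rightarrow> real) \<Rightarrow> real" where
  "coeff_norm d p = (\<Sum>\<alpha> | (\<Sum>i\<in>UNIV. \<alpha> i) = d. \<bar>p \<alpha>\<bar>)"

lemma coeff_norm_nonneg: "0 \<le> coeff_norm d p"
  by (simp add: coeff_norm_def sum_nonneg)

text \<open>Each coordinate is at most \<open>norm x\<close> in absolute value, hence each monomial
  of degree \<open>d\<close> is at most \<open>norm x ^ d\<close>.\<close>

lemma abs_poly_eval_le:
  assumes "p \<in> forms d"
  shows "\<bar>poly_eval p x\<bar> \<le> coeff_norm d p * norm x ^ d"
proof -
  have "\<bar>\<Prod>i\<in>UNIV. (x $ i) ^ \<alpha> i\<bar> \<le> norm x ^ d" if "(\<Sum>i\<in>UNIV. \<alpha> i) = d" for \<alpha>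
  proof -
    have "\<bar>\<Prod>i\<in>UNIV. (x $ i) ^ \<alpha> i\<bar> = (\<Prod>i\<in>UNIV. \<bar>x $ i\<bar> ^ \<alpha> i)"
      by (simp add: abs_prod power_abs)
    also have "\<dots> \<le> (\<Prod>i\<in>UNIV. norm x ^ \<alpha> i)"
      by (intro prod_mono conjI power_mono component_le_norm_cart) auto
    also have "\<dots> = norm x ^ d" using that by (simp flip: power_sum)
    finally show ?thesis .
  qed
  then show ?thesis
    unfolding poly_eval_form[OF assms] coeff_norm_def sum_distrib_right
    by (intro order_trans[OF sum_abs] sum_mono) (auto simp: abs_mult intro!: mult_left_mono)
qed

text \<open>The constant is the minimum of the form on the unit sphere, attained by compactness and
  positive there; homogeneity spreads the bound to all of space. This quantitative positivity drives
  all later estimates.\<close>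

lemma pos_form_lower_bound:
  fixes g :: "('n::finite \<Rightarrow> nat) \<Rightarrow> real"
  assumes "g \<in> pos_forms d" "d > 0"
  obtains c where "c > 0" "\<And>x. c * norm x ^ d \<le> poly_eval g x"
proof -
  have gf: "g \<in> forms d" and gpos: "\<And>x. x \<noteq> 0 \<Longrightarrow> 0 < poly_eval g x"
    using assms by (auto simp: pos_forms_def)
  obtain y where y: "y \<in> sphere (0 :: real ^ 'n) 1"
    and ymin: "\<And>z. z \<in> sphere 0 1 \<Longrightarrow> poly_eval g y \<le> poly_eval g z"
    using continuous_attains_inf[OF compact_sphere _ continuous_on_poly_eval, of "0 :: real ^ 'n" 1 g]
    by (auto simp del: mem_sphere)
  show ?thesis
  proof
    show "poly_eval g y > 0" using y by (intro gpos) auto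
    fix x :: "real ^ 'n"
    show "poly_eval g y * norm x ^ d \<le> poly_eval g x"
    proof (cases "x = 0")
      case True
      then show ?thesis using poly_eval_scaleR[OF gf, of 0 0] \<open>d > 0\<close>
        by (simp add: zero_power)
    next
      case False
      have "poly_eval g x = norm x ^ d * poly_eval g (x /\<^sub>R norm x)"
        using False by (subst poly_eval_scaleR[OF gf, symmetric]) simp
      moreover have "poly_eval g y \<le> poly_eval g (x /\<^sub>R norm x)"
        using False by (intro ymin) simp
      ultimately show ?thesis
        by (subst mult.commute) (simp add: mult_left_mono)
    qed
  qed
qed

lemma lower_bound_imp_pos_form:
  assumes "g \<in> forms d" "c > 0" "\<And>x. c * norm x ^ d \<le> poly_eval g x"
  shows "g \<in> pos_forms d"
  unfolding pos_forms_def using assms by (auto intro!: less_le_trans[OF _ assms(3)])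

lemma pos_form_nonneg:
  assumes "g \<in> pos_forms d" "d > 0"
  shows "0 \<le> poly_eval g x"
proof -
  obtain c where "c > 0" "\<And>x. c * norm x ^ d \<le> poly_eval g x"
    using pos_form_lower_bound[OF assms] by blast
  then show ?thesis by (meson less_imp_le norm_ge_zero mult_nonneg_nonneg order_trans zero_le_power)
qed

lemma abs_integral_le:
  fixes f g :: "'a \<Rightarrow> real"
  assumes "\<And>x. \<bar>f x\<bar> \<le> g x" "integrable M f" "integrable M g"
  shows "\<bar>integral\<^sup>L M f\<bar> \<le> integral\<^sup>L M g"
proof -
  have "\<bar>integral\<^sup>L M f\<bar> \<le> (LINT x|M. \<bar>f x\<bar>)" by (rule integral_abs_bound)
  also have "\<dots> \<le> integral\<^sup>L M g" using assms by (intro integral_mono) auto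
  finally show ?thesis .
qed

section \<open>Differentiability and continuity of exponential integrals in the form\<close>

text \<open>Taylor's theorem with Lagrange remainder. This first-order bound gives continuity and
  the second-order one below gives differentiability. The factor \<open>exp \<bar>s\<bar>\<close> is
  affordable because \<open>s\<close> will be a perturbation of \<open>g\<close> of at most half its
  lower bound.\<close>

lemma abs_exp_minus_one_le: "\<bar>exp s - 1\<bar> \<le> \<bar>s\<bar> * exp \<bar>s\<bar>" for s :: real
proof -
  obtain t where "\<bar>t\<bar> \<le> \<bar>s\<bar>" "exp s = 1 + exp t * s"
    using Maclaurin_exp_le[of s 1] by auto
  moreover have "exp t \<le> exp \<bar>s\<bar>" using calculation by simp
  ultimately show ?thesis by (simp add: abs_mult mult.commute mult_left_mono)
qed

lemma abs_exp_minus_one_minus_le: "\<bar>exp s - 1 - s\<bar> \<le> s\<^sup>2 * exp \<bar>s\<bar>" for s :: real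
proof -
  obtain t where "\<bar>t\<bar> \<le> \<bar>s\<bar>" "exp s = 1 + s + exp t / 2 * s\<^sup>2"
    using Maclaurin_exp_le[of s 2] by (auto simp: numeral_2_eq_2)
  moreover have "exp t / 2 \<le> exp \<bar>s\<bar>"
    using calculation by (smt (verit) exp_gt_zero exp_le_cancel_iff field_sum_of_halves)
  ultimately show ?thesis
    using mult_right_mono[of "exp t / 2" "exp \<bar>s\<bar>" "s\<^sup>2"] by (simp add: mult.commute)
qed

text \<open>Allowing a general weight \<open>q\<close> makes the family closed under differentiation
  in \<open>g\<close>, up to sign: a derivative along \<open>v\<close> only multiplies the weight by
  the values of \<open>v\<close>.\<close>

definition exp_moment :: "(real ^ 'n \<Rightarrow> real) \<Rightarrow> (('n::finite \<Rightarrow> nat) \<Rightarrow> real) \<Rightarrow> real" where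
  "exp_moment q g = (LINT x|lborel. q x * exp (- poly_eval g x))"

text \<open>The Taylor remainder of the integrand is at most \<open>t\<^sup>2\<close> times an
  integrable function independent of \<open>t\<close>, so the difference quotient is within a
  multiple of \<open>\<bar>t\<bar>\<close> of its limit. The direction may be any form of degree
  \<open>d\<close>, as smoothness demands.\<close>

lemma exp_moment_has_derivative:
  fixes q :: "real ^ 'n::finite \<Rightarrow> real"
  assumes "g \<in> pos_forms d" "v \<in> forms d" "d > 0"
    and [measurable]: "q \<in> borel_measurable borel"
    and q: "\<And>x. \<bar>q x\<bar> \<le> K * norm x ^ m"
  shows "((\<lambda>t. exp_moment q (\<lambda>\<alpha>. g \<alpha> + t * v \<alpha>)) has_real_derivative
    - exp_moment (\<lambda>x. q x * poly_eval v x) g) (at 0)"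
proof -
  obtain c where c: "c > 0" "\<And>x. c * norm x ^ d \<le> poly_eval g x"
    using pos_form_lower_bound[OF assms(1,3)] by blast
  have gf: "g \<in> forms d" using assms by (simp add: pos_forms_def)
  \<comment> \<open>Adding 1 keeps \<open>N\<close> positive even for \<open>v = 0\<close>, so that
    dividing by it below is legitimate.\<close>
  define N where "N = coeff_norm d v + 1"
  have N: "N > 0" using coeff_norm_nonneg[of d v] by (simp add: N_def)
  have v: "\<bar>poly_eval v x\<bar> \<le> N * norm x ^ d" for x
    using abs_poly_eval_le[OF assms(2), of x] 
    by (rule order_trans) (auto simp: N_def intro!: mult_right_mono)
  \<comment> \<open>Chosen so that \<open>\<bar>t\<bar> < \<delta>\<close> forces
    \<open>\<bar>t * poly_eval v x\<bar> \<le> c / 2 * norm x ^ d\<close>, half of the lower bound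
    for \<open>g\<close>.\<close>
  define \<delta> where "\<delta> = c / (2 * N)"
  have "\<delta> > 0" using c N by (simp add: \<delta>_def)
  have K: "K * norm x ^ m \<ge> 0" for x :: "real ^ 'n" using q[of x] by linarith
  have qv: "\<bar>q x * poly_eval v x\<bar> \<le> (K * N) * norm x ^ (m + d)" for x
    using mult_mono[OF q v, of x x] K[of x] by (simp add: abs_mult power_add mult_ac)
  have qvv: "\<bar>\<bar>q x\<bar> * (poly_eval v x)\<^sup>2\<bar> \<le> (K * N\<^sup>2) * norm x ^ (m + d * 2)" for x
  proof -
    have "(poly_eval v x)\<^sup>2 \<le> (N * norm x ^ d)\<^sup>2"
      using power_mono[OF v[of x], of 2] by simp
    from mult_mono[OF q[of x] this] K[of x] show ?thesis
      by (simp add: abs_mult power_add power_mult_distrib power_mult mult_ac)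
  qed
  \<comment> \<open>One half of the lower bound for \<open>g\<close> absorbs the factor
    \<open>exp \<bar>s\<bar>\<close> of the Taylor estimate; the other half remains here and ensures
    integrability.\<close>
  define B where "B = (LINT x|lborel. (\<bar>q x\<bar> * (poly_eval v x)\<^sup>2) * exp (- (c / 2 * norm x ^ d)))"
  have int_B: "integrable lborel (\<lambda>x. (\<bar>q x\<bar> * (poly_eval v x)\<^sup>2) * exp (- (c / 2 * norm x ^ d)))"
    using qvv c \<open>d > 0\<close> by (intro integrable_mult_exp[where c = "c / 2" and d = d]) auto
  have int_0: "integrable lborel (\<lambda>x. q x * exp (- poly_eval g x))"
    using q c \<open>d > 0\<close> by (intro integrable_mult_exp[where c = c and d = d]) auto
  have int_1: "integrable lborel (\<lambda>x. q x * poly_eval v x * exp (- poly_eval g x))"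
    using qv c \<open>d > 0\<close> by (intro integrable_mult_exp[where c = c and d = d]) auto
  let ?I = "\<lambda>t. exp_moment q (\<lambda>\<alpha>. g \<alpha> + t * v \<alpha>)"
  let ?J = "exp_moment (\<lambda>x. q x * poly_eval v x) g"
  have key: "\<bar>?I t - ?I 0 + t * ?J\<bar> \<le> t\<^sup>2 * B" if t: "\<bar>t\<bar> < \<delta>" for t
  proof -
    have tv: "\<bar>t * poly_eval v x\<bar> \<le> c / 2 * norm x ^ d" for x
    proof -
      have "\<bar>t * poly_eval v x\<bar> \<le> \<delta> * (N * norm x ^ d)"
        unfolding abs_mult using t v[of x] \<open>\<delta> > 0\<close> by (intro mult_mono) auto
      then show ?thesis using N by (simp add: \<delta>_def)
    qed
    have eq: "poly_eval (\<lambda>\<alpha>. g \<alpha> + t * v \<alpha>) x = poly_eval g x + t * poly_eval v x" for x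
      by (rule poly_eval_add_scale[OF gf assms(2)])
    have int_t: "integrable lborel (\<lambda>x. q x * exp (- (poly_eval g x + t * poly_eval v x)))"
    proof (rule integrable_mult_exp[where c = "c / 2" and d = d, OF _ _ q])
      show "c / 2 * norm x ^ d \<le> poly_eval g x + t * poly_eval v x" for x
        using tv[of x] c(2)[of x] by (simp add: field_simps abs_le_iff)
    qed (use c \<open>d > 0\<close> in auto)
    have diff_eq: "?I t - ?I 0 + t * ?J = (LINT x|lborel. q x * exp (- (poly_eval g x + t * poly_eval v x))
        - q x * exp (- poly_eval g x) + t * (q x * poly_eval v x * exp (- poly_eval g x)))"
      unfolding exp_moment_def eq using int_t int_0 int_1 by simp
    have "\<bar>?I t - ?I 0 + t * ?J\<bar> \<le> (LINT x|lborel. t\<^sup>2 * (\<bar>q x\<bar> * (poly_eval v x)\<^sup>2 * exp (- (c / 2 * norm x ^ d))))"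
      unfolding diff_eq
    proof (rule abs_integral_le)
      fix x
      let ?s = "- (t * poly_eval v x)"
      have eq: "q x * exp (- (poly_eval g x + t * poly_eval v x)) - q x * exp (- poly_eval g x)
          + t * (q x * poly_eval v x * exp (- poly_eval g x))
          = q x * (exp (- poly_eval g x) * (exp ?s - 1 - ?s))"
        by (simp add: exp_add exp_diff exp_minus field_simps)
      have le: "exp (- poly_eval g x) * \<bar>exp ?s - 1 - ?s\<bar> \<le>
          (t * poly_eval v x)\<^sup>2 * exp (- (c / 2 * norm x ^ d))"
      proof -
        have "exp (- poly_eval g x) * \<bar>exp ?s - 1 - ?s\<bar> \<le>
            exp (- poly_eval g x) * (?s\<^sup>2 * exp \<bar>?s\<bar>)"
          by (intro mult_left_mono abs_exp_minus_one_minus_le) auto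
        also have "\<dots> = (t * poly_eval v x)\<^sup>2 * exp (\<bar>t * poly_eval v x\<bar> - poly_eval g x)"
          by (simp add: exp_diff exp_minus field_simps)
        also have "\<dots> \<le> (t * poly_eval v x)\<^sup>2 * exp (- (c / 2 * norm x ^ d))"
          using tv[of x] c(2)[of x] by (intro mult_left_mono) auto
        finally show ?thesis .
      qed
      have "\<bar>q x * exp (- (poly_eval g x + t * poly_eval v x)) - q x * exp (- poly_eval g x)
          + t * (q x * poly_eval v x * exp (- poly_eval g x))\<bar> =
          \<bar>q x\<bar> * (exp (- poly_eval g x) * \<bar>exp ?s - 1 - ?s\<bar>)"
        unfolding eq abs_mult by simp
      also have "\<dots> \<le> \<bar>q x\<bar> * ((t * poly_eval v x)\<^sup>2 * exp (- (c / 2 * norm x ^ d)))"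
        by (intro mult_left_mono le) simp
      also have "\<dots> = t\<^sup>2 * (\<bar>q x\<bar> * (poly_eval v x)\<^sup>2 * exp (- (c / 2 * norm x ^ d)))"
        by (simp add: power_mult_distrib mult_ac)
      finally show "\<bar>q x * exp (- (poly_eval g x + t * poly_eval v x)) - q x * exp (- poly_eval g x)
          + t * (q x * poly_eval v x * exp (- poly_eval g x))\<bar>
          \<le> t\<^sup>2 * (\<bar>q x\<bar> * (poly_eval v x)\<^sup>2 * exp (- (c / 2 * norm x ^ d)))" .
    next
      show "integrable lborel (\<lambda>x. q x * exp (- (poly_eval g x + t * poly_eval v x))
          - q x * exp (- poly_eval g x) + t * (q x * poly_eval v x * exp (- poly_eval g x)))"
        by (rule Bochner_Integration.integrable_add[OF Bochner_Integration.integrable_diff[OF int_t int_0]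
          integrable_mult_right[OF int_1]])
      show "integrable lborel (\<lambda>x. t\<^sup>2 * (\<bar>q x\<bar> * (poly_eval v x)\<^sup>2 * exp (- (c / 2 * norm x ^ d))))"
        by (rule integrable_mult_right[OF int_B])
    qed
    also have "\<dots> = t\<^sup>2 * B" unfolding B_def by (rule integral_mult_right_zero)
    finally show ?thesis .
  qed
  have "((\<lambda>t. (?I t - ?I 0) / t - (- ?J)) \<longlongrightarrow> 0) (at 0)"
  proof (rule Lim_null_comparison)
    have "((\<lambda>t. \<bar>t\<bar> * B) \<longlongrightarrow> \<bar>0\<bar> * B) (at 0)" by (intro tendsto_intros)
    then show "((\<lambda>t. \<bar>t\<bar> * B) \<longlongrightarrow> 0) (at 0)" by simp
    show "\<forall>\<^sub>F t in at 0. norm ((?I t - ?I 0) / t - (- ?J)) \<le> \<bar>t\<bar> * B"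
      unfolding eventually_at
    proof (intro exI[of _ \<delta>] conjI ballI impI \<open>\<delta> > 0\<close>)
      fix t :: real assume "t \<noteq> 0 \<and> dist t 0 < \<delta>"
      then have t: "t \<noteq> 0" "\<bar>t\<bar> < \<delta>" by (auto simp: dist_real_def)
      have "(?I t - ?I 0) / t - (- ?J) = (?I t - ?I 0 + t * ?J) / t"
        using t by (simp add: field_simps)
      then have "norm ((?I t - ?I 0) / t - (- ?J)) = \<bar>?I t - ?I 0 + t * ?J\<bar> / \<bar>t\<bar>"
        by (simp add: abs_divide)
      also have "\<dots> \<le> t\<^sup>2 * B / \<bar>t\<bar>" using key[OF t(2)] by (intro divide_right_mono) auto
      also have "\<dots> = \<bar>t\<bar> * B" using t by (simp add: power2_eq_square abs_if)
      finally show "norm ((?I t - ?I 0) / t - (- ?J)) \<le> \<bar>t\<bar> * B" .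
    qed
  qed
  from LIM_zero_cancel[OF this] show ?thesis
    by (simp add: has_field_derivative_iff)
qed

text \<open>The same estimate to first order: near \<open>g\<close>, the change of the integral is
  at most a constant times the coefficient distance to \<open>g\<close>.\<close>

lemma continuous_on_exp_moment:
  fixes q :: "real ^ 'n::finite \<Rightarrow> real"
  assumes "d > 0" and [measurable]: "q \<in> borel_measurable borel"
    and q: "\<And>x. \<bar>q x\<bar> \<le> K * norm x ^ m"
  shows "continuous_on (pos_forms d) (exp_moment q)"
  unfolding continuous_on_def
proof
  fix g :: "('n \<Rightarrow> nat) \<Rightarrow> real" assume g: "g \<in> pos_forms d"
  obtain c where c: "c > 0" "\<And>x. c * norm x ^ d \<le> poly_eval g x"
    using pos_form_lower_bound[OF g \<open>d > 0\<close>] by blast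
  have gf: "g \<in> forms d" using g by (simp add: pos_forms_def)
  \<comment> \<open>\<open>D\<close> takes the role that \<open>\<bar>t\<bar>\<close> has for the
    derivative. It is continuous and vanishes at \<open>g\<close>, so \<open>D g' < c / 2\<close>
    holds near \<open>g\<close>.\<close>
  define D where "D = (\<lambda>g'. coeff_norm d (\<lambda>\<alpha>. g' \<alpha> - g \<alpha>))"
  define B where "B = (LINT x|lborel. (\<bar>q x\<bar> * norm x ^ d) * exp (- (c / 2 * norm x ^ d)))"
  have int_B: "integrable lborel (\<lambda>x. (\<bar>q x\<bar> * norm x ^ d) * exp (- (c / 2 * norm x ^ d)))"
    using c \<open>d > 0\<close>
    by (intro integrable_mult_exp[where c = "c / 2" and d = d and K = K and m = "m + d"])
      (auto simp: abs_mult power_add mult.assoc[symmetric] intro!: mult_right_mono q)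
  have int_0: "integrable lborel (\<lambda>x. q x * exp (- poly_eval g x))"
    using q c \<open>d > 0\<close> by (intro integrable_mult_exp[where c = c and d = d]) auto
  have "continuous_on UNIV D"
    unfolding D_def coeff_norm_def by (intro continuous_intros continuous_on_product_coordinates)
  then have "(D \<longlongrightarrow> D g) (at g within pos_forms d)"
    by (auto simp: continuous_on_def intro: tendsto_within_subset)
  then have D0: "(D \<longlongrightarrow> 0) (at g within pos_forms d)" by (simp add: D_def coeff_norm_def)
  have key: "\<bar>exp_moment q g' - exp_moment q g\<bar> \<le> D g' * B"
    if g': "g' \<in> pos_forms d" "D g' < c / 2" for g'
  proof -
    define v where "v = (\<lambda>\<alpha>. g' \<alpha> - g \<alpha>)"
    have v: "v \<in> forms d" using gf g' unfolding v_def pos_forms_def forms_def by force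
    have "poly_eval g' x = poly_eval (\<lambda>\<alpha>. g \<alpha> + 1 * v \<alpha>) x" for x by (simp add: v_def)
    then have eq: "poly_eval g' x = poly_eval g x + poly_eval v x" for x
      using poly_eval_add_scale[OF gf v, of 1] by simp
    have vD: "\<bar>poly_eval v x\<bar> \<le> D g' * norm x ^ d" for x
      using abs_poly_eval_le[OF v, of x] by (simp add: D_def v_def)
    have vc: "\<bar>poly_eval v x\<bar> \<le> c / 2 * norm x ^ d" for x
      using g'(2) by (intro order_trans[OF vD] mult_right_mono) auto
    have int_1: "integrable lborel (\<lambda>x. q x * exp (- (poly_eval g x + poly_eval v x)))"
    proof (rule integrable_mult_exp[where c = "c / 2" and d = d, OF _ _ q])
      show "c / 2 * norm x ^ d \<le> poly_eval g x + poly_eval v x" for x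
        using vc[of x] c(2)[of x] by (simp add: field_simps abs_le_iff)
    qed (use c \<open>d > 0\<close> in auto)
    have "exp_moment q g' - exp_moment q g = (LINT x|lborel.
        q x * exp (- (poly_eval g x + poly_eval v x)) - q x * exp (- poly_eval g x))"
      unfolding exp_moment_def eq using int_1 int_0 by simp
    also have "\<bar>\<dots>\<bar> \<le> (LINT x|lborel. D g' * (\<bar>q x\<bar> * norm x ^ d * exp (- (c / 2 * norm x ^ d))))"
    proof (rule abs_integral_le)
      fix x
      let ?s = "- poly_eval v x"
      have eq: "q x * exp (- (poly_eval g x + poly_eval v x)) - q x * exp (- poly_eval g x)
          = q x * (exp (- poly_eval g x) * (exp ?s - 1))"
        by (simp add: exp_add exp_diff exp_minus field_simps)
      have le: "exp (- poly_eval g x) * \<bar>exp ?s - 1\<bar> \<le>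
          D g' * norm x ^ d * exp (- (c / 2 * norm x ^ d))"
      proof -
        have "exp (- poly_eval g x) * \<bar>exp ?s - 1\<bar> \<le> exp (- poly_eval g x) * (\<bar>?s\<bar> * exp \<bar>?s\<bar>)"
          by (intro mult_left_mono abs_exp_minus_one_le) auto
        also have "\<dots> = \<bar>poly_eval v x\<bar> * exp (\<bar>poly_eval v x\<bar> - poly_eval g x)"
          by (simp add: exp_diff exp_minus field_simps)
        also have "\<dots> \<le> (D g' * norm x ^ d) * exp (- (c / 2 * norm x ^ d))"
          using vD[of x] vc[of x] c(2)[of x]
          by (intro mult_mono) (auto intro: order_trans[OF abs_ge_zero])
        finally show ?thesis .
      qed
      have "\<bar>q x * exp (- (poly_eval g x + poly_eval v x)) - q x * exp (- poly_eval g x)\<bar> =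
          \<bar>q x\<bar> * (exp (- poly_eval g x) * \<bar>exp ?s - 1\<bar>)"
        unfolding eq abs_mult by simp
      also have "\<dots> \<le> \<bar>q x\<bar> * (D g' * norm x ^ d * exp (- (c / 2 * norm x ^ d)))"
        by (intro mult_left_mono le) simp
      also have "\<dots> = D g' * (\<bar>q x\<bar> * norm x ^ d * exp (- (c / 2 * norm x ^ d)))"
        by (simp add: power_mult_distrib mult_ac)
      finally show "\<bar>q x * exp (- (poly_eval g x + poly_eval v x)) - q x * exp (- poly_eval g x)\<bar>
          \<le> D g' * (\<bar>q x\<bar> * norm x ^ d * exp (- (c / 2 * norm x ^ d)))" .
    qed (use int_1 int_0 int_B in auto)
    also have "\<dots> = D g' * B" by (simp add: B_def)
    finally show ?thesis .
  qed
  have "((\<lambda>g'. exp_moment q g' - exp_moment q g) \<longlongrightarrow> 0) (at g within pos_forms d)"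
  proof (rule Lim_null_comparison)
    show "((\<lambda>g'. D g' * B) \<longlongrightarrow> 0) (at g within pos_forms d)"
      using tendsto_mult_left_zero[OF D0] .
    have "\<forall>\<^sub>F g' in at g within pos_forms d. g' \<in> pos_forms d"
      by (auto simp: eventually_at_filter)
    moreover have "\<forall>\<^sub>F g' in at g within pos_forms d. D g' < c / 2"
      using c by (intro order_tendstoD(2)[OF D0]) auto
    ultimately show "\<forall>\<^sub>F g' in at g within pos_forms d.
        norm (exp_moment q g' - exp_moment q g) \<le> D g' * B"
      by eventually_elim (use key in simp)
  qed
  then show "(exp_moment q \<longlongrightarrow> exp_moment q g) (at g within pos_forms d)"
    by (simp add: LIM_zero_iff)
qed

text \<open>Openness of the cone along lines: for small \<open>t\<close> the perturbation costs at
  most half of the lower bound for \<open>g\<close>. This makes directional derivatives depend only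
  on values within the cone.\<close>

lemma eventually_pos_form_line:
  assumes "g \<in> pos_forms d" "v \<in> forms d" "d > 0"
  shows "\<forall>\<^sub>F t in nhds 0. (\<lambda>\<alpha>. g \<alpha> + t * v \<alpha>) \<in> pos_forms d"
proof -
  obtain c where c: "c > 0" "\<And>x. c * norm x ^ d \<le> poly_eval g x"
    using pos_form_lower_bound[OF assms(1,3)] by blast
  have gf: "g \<in> forms d" using assms by (simp add: pos_forms_def)
  have "((\<lambda>t. \<bar>t\<bar> * coeff_norm d v) \<longlongrightarrow> \<bar>0\<bar> * coeff_norm d v) (nhds 0)"
    by (intro tendsto_intros filterlim_ident)
  then have "\<forall>\<^sub>F t in nhds 0. \<bar>t\<bar> * coeff_norm d v < c / 2"
    using c by (intro order_tendstoD(2)) auto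
  then show ?thesis
  proof eventually_elim
    case (elim t)
    show ?case
    proof (rule lower_bound_imp_pos_form[OF forms_add_scale[OF gf assms(2)]])
      fix x
      have "\<bar>t * poly_eval v x\<bar> \<le> \<bar>t\<bar> * (coeff_norm d v * norm x ^ d)"
        unfolding abs_mult by (intro mult_left_mono abs_poly_eval_le assms) auto
      also have "\<dots> \<le> c / 2 * norm x ^ d"
        using elim by (simp only: mult.assoc[symmetric]) (intro mult_right_mono, auto)
      finally show "c / 2 * norm x ^ d \<le> poly_eval (\<lambda>\<alpha>. g \<alpha> + t * v \<alpha>) x"
        using c(2)[of x] by (simp add: poly_eval_add_scale[OF gf assms(2)] abs_le_iff field_simps)
    qed (use c in simp)
  qed
qed

section \<open>Iterated derivatives and complete monotonicity\<close>

text \<open>The weight left, apart from sign, after differentiating along all members of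
  \<open>vs\<close>.\<close>

definition times_forms ::
    "(real ^ 'n \<Rightarrow> real) \<Rightarrow> (('n::finite \<Rightarrow> nat) \<Rightarrow> real) list \<Rightarrow> real ^ 'n \<Rightarrow> real" where
  "times_forms q vs x = q x * prod_list (map (\<lambda>v. poly_eval v x) vs)"

lemma borel_measurable_times_forms [measurable]:
  "q \<in> borel_measurable borel \<Longrightarrow> times_forms q vs \<in> borel_measurable borel"
proof -
  assume [measurable]: "q \<in> borel_measurable borel"
  have [measurable]: "(\<lambda>x. prod_list (map (\<lambda>v. poly_eval v x) vs)) \<in> borel_measurable borel"
    by (induction vs) auto
  show ?thesis unfolding times_forms_def by measurable
qed

text \<open>\<open>K\<close> and \<open>m\<close> are quantified existentially because every factor
  changes them: \<open>K\<close> is multiplied by a coefficient norm and \<open>m\<close> grows by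
  \<open>d\<close>.\<close>

lemma times_forms_bound:
  assumes "set vs \<subseteq> forms d" "\<exists>K m. \<forall>x. \<bar>q x\<bar> \<le> K * norm x ^ m"
  shows "\<exists>K m. \<forall>x. \<bar>times_forms q vs x\<bar> \<le> K * norm x ^ m"
  using assms(1)
proof (induction vs)
  case Nil
  then show ?case using assms(2) by (simp add: times_forms_def)
next
  case (Cons v vs)
  then obtain K m where K: "\<And>x. \<bar>times_forms q vs x\<bar> \<le> K * norm x ^ m" by auto
  have "\<bar>times_forms q (v # vs) x\<bar> \<le> (K * coeff_norm d v) * norm x ^ (m + d)" for x
  proof -
    have "\<bar>times_forms q (v # vs) x\<bar> = \<bar>times_forms q vs x\<bar> * \<bar>poly_eval v x\<bar>"
      by (simp add: times_forms_def abs_mult)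
    also have "\<dots> \<le> (K * norm x ^ m) * (coeff_norm d v * norm x ^ d)"
      using Cons.prems by (intro mult_mono K abs_poly_eval_le)
        (auto intro: order_trans[OF abs_ge_zero K])
    finally show ?thesis by (simp add: power_add mult_ac)
  qed
  then show ?case by blast
qed

text \<open>\<open>F\<close> is tied to \<open>exp_moment\<close> on the cone only. That suffices
  because each derivative is local and the cone is open along lines.\<close>

lemma iterated_dir_deriv_exp_moment:
  fixes q :: "real ^ 'n::finite \<Rightarrow> real"
  assumes "d > 0" "q \<in> borel_measurable borel" "\<exists>K m. \<forall>x. \<bar>q x\<bar> \<le> K * norm x ^ m"
    and F: "\<And>g. g \<in> pos_forms d \<Longrightarrow> F g = A * exp_moment q g"
    and "set vs \<subseteq> forms d" "g \<in> pos_forms d"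
  shows "foldr dir_deriv vs F g = A * (-1) ^ length vs * exp_moment (times_forms q vs) g"
    and "v \<in> forms d \<Longrightarrow>
      ((\<lambda>t. foldr dir_deriv vs F (\<lambda>\<alpha>. g \<alpha> + t * v \<alpha>)) has_real_derivative
        A * (-1) ^ length (v # vs) * exp_moment (times_forms q (v # vs)) g) (at 0)"
proof -
  \<comment> \<open>The formula for \<open>vs\<close> is a premise here, at every point of the cone.
    The fact therefore supplies the induction step of \<open>iterate\<close>, and afterwards the
    second claim.\<close>
  have deriv: "((\<lambda>t. foldr dir_deriv vs F (\<lambda>\<alpha>. g \<alpha> + t * v \<alpha>)) has_real_derivative
        A * (-1) ^ length (v # vs) * exp_moment (times_forms q (v # vs)) g) (at 0)"
    if vs: "set vs \<subseteq> forms d" and g: "g \<in> pos_forms d" and v: "v \<in> forms d"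
      and eq: "\<And>g. g \<in> pos_forms d \<Longrightarrow>
        foldr dir_deriv vs F g = A * (-1) ^ length vs * exp_moment (times_forms q vs) g"
    for vs and g v :: "('n \<Rightarrow> nat) \<Rightarrow> real"
  proof -
    obtain K m where "\<And>x. \<bar>times_forms q vs x\<bar> \<le> K * norm x ^ m"
      using times_forms_bound[OF vs assms(3)] by blast
    from exp_moment_has_derivative[OF g v \<open>d > 0\<close> borel_measurable_times_forms[OF assms(2)] this]
    have "((\<lambda>t. A * (-1) ^ length vs * exp_moment (times_forms q vs) (\<lambda>\<alpha>. g \<alpha> + t * v \<alpha>))
        has_real_derivative A * (-1) ^ length vs *
          - exp_moment (\<lambda>x. times_forms q vs x * poly_eval v x) g) (at 0)"
      by (rule DERIV_cmult)
    moreover have "(\<lambda>x. times_forms q vs x * poly_eval v x) = times_forms q (v # vs)"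
      by (simp add: times_forms_def fun_eq_iff)
    moreover have "\<forall>\<^sub>F t in nhds 0. foldr dir_deriv vs F (\<lambda>\<alpha>. g \<alpha> + t * v \<alpha>) =
        A * (-1) ^ length vs * exp_moment (times_forms q vs) (\<lambda>\<alpha>. g \<alpha> + t * v \<alpha>)"
      using eventually_pos_form_line[OF g v \<open>d > 0\<close>] by eventually_elim (rule eq)
    ultimately show ?thesis
      by (subst DERIV_cong_ev[OF refl _ refl]) auto
  qed
  have iterate: "foldr dir_deriv vs F g = A * (-1) ^ length vs * exp_moment (times_forms q vs) g"
    if "set vs \<subseteq> forms d" "g \<in> pos_forms d" for vs and g :: "('n \<Rightarrow> nat) \<Rightarrow> real"
    using that
  proof (induction vs arbitrary: g)
    case Nil
    then show ?case using F by (simp add: times_forms_def[abs_def])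
  next
    case (Cons v vs)
    then show ?case
      using DERIV_imp_deriv[OF deriv[of vs g v]]
      by (simp add: dir_deriv_def[of v "foldr dir_deriv vs F" g])
  qed
  show "foldr dir_deriv vs F g = A * (-1) ^ length vs * exp_moment (times_forms q vs) g"
    by (rule iterate[OF assms(5,6)])
  show "((\<lambda>t. foldr dir_deriv vs F (\<lambda>\<alpha>. g \<alpha> + t * v \<alpha>)) has_real_derivative
        A * (-1) ^ length (v # vs) * exp_moment (times_forms q (v # vs)) g) (at 0)"
    if "v \<in> forms d" by (rule deriv[OF assms(5,6) that iterate[OF assms(5)]])
qed

text \<open>Each differentiation contributes a factor -1, cancelled by the alternating sign in the
  definition. What remains is the integral of \<open>q\<close>, values of forms from the cone and an
  exponential, all nonnegative.\<close>

lemma completely_monotone_on_exp_moment: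
  fixes q :: "real ^ 'n::finite \<Rightarrow> real"
  assumes "d > 0" "q \<in> borel_measurable borel" "\<And>x. \<bar>q x\<bar> \<le> K * norm x ^ m"
    and "\<And>x. 0 \<le> q x" "0 \<le> A"
    and F: "\<And>g. g \<in> pos_forms d \<Longrightarrow> F g = A * exp_moment q g"
  shows "completely_monotone_on (forms d) (pos_forms d) F"
  unfolding completely_monotone_on_def smooth_on_def
proof (intro conjI allI impI ballI)
  have bound: "\<exists>K m. \<forall>x. \<bar>q x\<bar> \<le> K * norm x ^ m" using assms(3) by blast
  note deriv = iterated_dir_deriv_exp_moment[OF assms(1,2) bound F]
  show "continuous_on (pos_forms d) (foldr dir_deriv vs F)" if vs: "set vs \<subseteq> forms d" for vs
  proof -
    obtain K m where "\<And>x. \<bar>times_forms q vs x\<bar> \<le> K * norm x ^ m"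
      using times_forms_bound[OF vs bound] by blast
    then have "continuous_on (pos_forms d) (exp_moment (times_forms q vs))"
      using assms by (intro continuous_on_exp_moment) auto
    then have "continuous_on (pos_forms d) (\<lambda>g. A * (-1) ^ length vs * exp_moment (times_forms q vs) g)"
      by (intro continuous_intros)
    then show ?thesis by (rule continuous_on_eq) (use deriv(1) vs in auto)
  qed
  show "(\<lambda>t. foldr dir_deriv vs F (\<lambda>i. g i + t * v i)) differentiable at 0"
    if "set vs \<subseteq> forms d" "v \<in> forms d" "g \<in> pos_forms d" for vs v g
    using deriv(2)[OF _ that(1,3,2)] by (auto simp: real_differentiable_def)
  show "0 \<le> (-1) ^ length vs * foldr dir_deriv vs F g"
    if vs: "set vs \<subseteq> pos_forms d" and g: "g \<in> pos_forms d" for vs g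
  proof -
    have "0 \<le> prod_list (map (\<lambda>v. poly_eval v x) vs)" for x
      using vs by (induction vs) (auto intro: mult_nonneg_nonneg pos_form_nonneg[OF _ \<open>d > 0\<close>])
    then have "0 \<le> exp_moment (times_forms q vs) g"
      unfolding exp_moment_def times_forms_def using assms(4) by (intro Bochner_Integration.integral_nonneg) simp
    moreover have "set vs \<subseteq> forms d" using vs by (auto simp: pos_forms_def)
    ultimately show ?thesis
      using deriv(1)[of vs g] g \<open>0 \<le> A\<close> by (cases "even (length vs)") auto
  qed
qed

theorem mainTheorem7:
  fixes d e :: nat
    and h :: "('n::finite \<Rightarrow> nat) \<Rightarrow> real"
  assumes "2 \<le> d" and "even d" and "even e"
    and "h \<in> nonneg_forms e"
  shows "completely_monotone_on (forms d) (pos_forms d)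
    (\<lambda>g. LINT x:{x. poly_eval g x \<le> 1}|lborel. poly_eval h x)"
proof -
  have d: "d > 0" using assms by simp
  have hf: "h \<in> forms e" and hpos: "\<And>x. 0 \<le> poly_eval h x"
    using assms by (auto simp: nonneg_forms_def)
  \<comment> \<open>The dimension of the domain is \<open>CARD('n)\<close>. The constant is positive
    and independent of \<open>g\<close>, so its inverse can serve as the factor
    \<open>A\<close>.\<close>
  let ?\<Gamma> = "Gamma (1 + (CARD('n) + e) / d)"
  have "0 < 1 + (CARD('n) + e) / d" by (simp add: add_pos_nonneg)
  then have \<Gamma>: "?\<Gamma> > 0" by (rule Gamma_real_pos)
  show ?thesis
  proof (rule completely_monotone_on_exp_moment[OF d borel_measurable_poly_eval abs_poly_eval_le[OF hf] hpos])
    show "0 \<le> 1 / ?\<Gamma>" using \<Gamma> by simp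
    fix g :: "('n \<Rightarrow> nat) \<Rightarrow> real" assume g: "g \<in> pos_forms d"
    then have gf: "g \<in> forms d" by (simp add: pos_forms_def)
    have "exp_moment (poly_eval h) g =
        ?\<Gamma> * (LINT x:{x. poly_eval g x \<le> 1}|lborel. poly_eval h x)"
      unfolding exp_moment_def
      using integral_homogeneous_exp[of "poly_eval g" "poly_eval h" d e] d hpos
        pos_form_nonneg[OF g d] poly_eval_scaleR[OF gf] poly_eval_scaleR[OF hf]
      by simp
    then show "(LINT x:{x. poly_eval g x \<le> 1}|lborel. poly_eval h x) =
        1 / ?\<Gamma> * exp_moment (poly_eval h) g"
      using \<Gamma> by simp
  qed
qed

end
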